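(* Let $\alpha\in(0,1)$ and $\beta=\frac1{1-\alpha}$. In the asymptotic model of an infinite $\alpha$-full hash table with random probing and the Robin Hood collision resolution discipline, let $X$ be the search cost (number of probes) of a randomly chosen key, whose distribution is given by $\Pr\{X\ge i\}=\frac{1}{\alpha}\bigl(1-e^{-r_i}\bigr)$ for $i\ge1$, where $r_1=\ln\beta$ and $r_{i+1}=r_i-1+e^{-r_i}$. Then the variance $\sigma_\alpha^2$ of $X$ satisfies $$\sigma_\alpha^2\le\frac{\pi^2}{3}+\frac13+O\!\left(\frac{\ln\beta}{\beta}\right)\quad\text{as }\beta\to\infty\ (\alpha\to1).$$
   Context: Asymptotic model: table of $m$ slots with $n$ keys, $n,m\to\infty$, $n/m=\alpha$; each key has an infinite i.i.d. uniform probe sequence; keys are inserted sequentially; a key at its $j$-th probe location has age (search cost) $j$. Robin Hood: each collision during insertion is resolved in favor of the key with larger age. In this model the double tail $r_i=\bar{\bar q}_i$ of $q_i=\alpha\Pr\{X=i\}$ satisfies the stated recurrence, and $\Pr\{X\ge i\}=\frac1\alpha(r_i-r_{i+1})$. *)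

theory Defs
  imports "HOL-Probability.Probability" "HOL-Library.Landau_Symbols"
begin

definition beta :: "real \<Rightarrow> real" where
  "beta \<alpha> = 1 / (1 - \<alpha>)"

text \<open>Only indices \<open>i \<ge> 1\<close> are meaningful; the value at index 0 is a dummy that is never used.\<close>

definition rh_r :: "real \<Rightarrow> nat \<Rightarrow> real" where
  "rh_r \<alpha> i = ((\<lambda>x. x - 1 + exp (- x)) ^^ (i - 1)) (ln (beta \<alpha>))"

text \<open>The law of the number of probes of a random key in the infinite \<open>\<alpha>\<close>-full table. It enters
  through its tail; the tail at 1 equals 1, so \<open>X \<ge> 1\<close> almost surely.\<close>

definition robin_hood_search_cost :: "real \<Rightarrow> 'a measure \<Rightarrow> ('a \<Rightarrow> nat) \<Rightarrow> bool" where
  "robin_hood_search_cost \<alpha> M X \<longleftrightarrow>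
     prob_space M \<and> X \<in> M \<rightarrow>\<^sub>M count_space UNIV \<and>
     (\<forall>i\<ge>1. measure M {\<omega> \<in> space M. i \<le> X \<omega>} = (1 - exp (- rh_r \<alpha> i)) / \<alpha>)"

lemma rh_r_1: "rh_r \<alpha> 1 = ln (beta \<alpha>)"
  by (simp add: rh_r_def)

lemma rh_r_Suc: "i \<ge> 1 \<Longrightarrow> rh_r \<alpha> (Suc i) = rh_r \<alpha> i - 1 + exp (- rh_r \<alpha> i)"
  by (cases i) (simp_all add: rh_r_def)

lemma rh_r_pos:
  assumes "0 < \<alpha>" "\<alpha> < 1" "i \<ge> 1"
  shows "rh_r \<alpha> i > 0"
  using assms(3)
proof (induction i rule: dec_induct)
  case base
  show ?case using assms by (simp add: rh_r_1[unfolded One_nat_def] beta_def)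
next
  case (step n)
  have "exp (- rh_r \<alpha> n) \<noteq> 1 + (- rh_r \<alpha> n)"
    using exp_minus_greater step.IH by (metis diff_conv_add_uminus less_irrefl not_less_iff_gr_or_eq)
  moreover have "exp (- rh_r \<alpha> n) \<ge> 1 + (- rh_r \<alpha> n)" by (rule exp_ge_add_one_self)
  ultimately show ?case using step.hyps by (simp add: rh_r_Suc)
qed

lemma rh_r_tendsto_0:
  assumes "0 < \<alpha>" "\<alpha> < 1"
  shows "(\<lambda>k. rh_r \<alpha> (i + Suc k)) \<longlonglongrightarrow> 0"
proof -
  let ?f = "\<lambda>k. rh_r \<alpha> (Suc k)"
  have pos: "?f k > 0" for k using rh_r_pos[OF assms] by simp
  have rec: "?f (Suc k) = ?f k - 1 + exp (- ?f k)" for k by (rule rh_r_Suc) simp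
  have dec: "decseq ?f"
    unfolding decseq_Suc_iff using pos by (simp add: rec less_imp_le)
  obtain L where L: "?f \<longlonglongrightarrow> L"
    using decseq_convergent[OF dec, of 0] pos by (metis less_imp_le)
  have "(\<lambda>k. ?f k - 1 + exp (- ?f k)) \<longlonglongrightarrow> L - 1 + exp (- L)"
    by (intro tendsto_intros L)
  moreover have "(\<lambda>k. ?f (Suc k)) \<longlonglongrightarrow> L" using L by (rule LIMSEQ_Suc)
  ultimately have "L = L - 1 + exp (- L)"
    unfolding rec by (rule LIMSEQ_unique[rotated])
  hence "L = 0" by simp
  thus ?thesis using LIMSEQ_ignore_initial_segment[OF L, of i] by (simp add: add.commute)
qed

text \<open>\<open>rh_r \<alpha>\<close> is the double tail of \<open>q\<^sub>i = \<alpha> Pr(X = i)\<close>.\<close>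

lemma rh_r_double_tail:
  assumes "0 < \<alpha>" "\<alpha> < 1" "robin_hood_search_cost \<alpha> M X" "i \<ge> 1"
  shows "(\<lambda>k. \<alpha> * measure M {\<omega> \<in> space M. i + k \<le> X \<omega>}) sums rh_r \<alpha> i"
proof -
  obtain j where j: "i = Suc j" using assms(4) by (cases i) auto
  have "(\<lambda>k. rh_r \<alpha> (j + Suc k) - rh_r \<alpha> (j + Suc (Suc k))) sums (rh_r \<alpha> (j + Suc 0) - 0)"
    by (rule telescope_sums'[OF rh_r_tendsto_0[OF assms(1,2)]])
  moreover have "rh_r \<alpha> (j + Suc k) - rh_r \<alpha> (j + Suc (Suc k))
      = \<alpha> * measure M {\<omega> \<in> space M. i + k \<le> X \<omega>}" for k
    using assms rh_r_Suc[of "j + Suc k" \<alpha>] by (simp add: j robin_hood_search_cost_def)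
  ultimately show ?thesis by (simp add: j)
qed

text \<open>Such a law exists for every load factor.\<close>

lemma robin_hood_search_cost_exists:
  assumes "0 < \<alpha>" "\<alpha> < 1"
  shows "\<exists>p :: nat pmf. robin_hood_search_cost \<alpha> (measure_pmf p) (\<lambda>i. i)"
proof -
  define T where "T = (\<lambda>i. if i = 0 then 1 else (1 - exp (- rh_r \<alpha> i)) / \<alpha>)"
  have T1: "T (Suc 0) = 1"
    using assms by (simp add: T_def rh_r_1[unfolded One_nat_def] beta_def exp_minus)
  have dec: "T (Suc i) \<le> T i" for i
  proof (cases "i = 0")
    case False
    hence "rh_r \<alpha> (Suc i) \<le> rh_r \<alpha> i"
      using rh_r_pos[OF assms, of i] by (simp add: rh_r_Suc)
    thus ?thesis using False assms by (simp add: T_def divide_right_mono)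
  qed (simp add: T1, simp add: T_def)
  have "(\<lambda>k. (1 - exp (- rh_r \<alpha> (Suc k))) / \<alpha>) \<longlonglongrightarrow> (1 - exp (- 0)) / \<alpha>"
    using rh_r_tendsto_0[OF assms, of 0] assms by (intro tendsto_intros) auto
  hence "(\<lambda>k. T (Suc k)) \<longlonglongrightarrow> 0" by (simp add: T_def)
  hence lim: "T \<longlonglongrightarrow> 0" by (rule LIMSEQ_imp_Suc)
  have sums: "(\<lambda>i. T i - T (Suc i)) sums 1"
    using telescope_sums'[OF lim] by (simp add: T_def)
  define p where "p = embed_pmf (\<lambda>i. T i - T (Suc i))"
  have "(\<integral>\<^sup>+ i. ennreal (T i - T (Suc i)) \<partial>count_space UNIV) = 1"
    using sums dec
    by (simp add: nn_integral_count_space_nat suminf_ennreal2 sums_summable sums_unique[symmetric])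
  hence pmf_p: "pmf p i = T i - T (Suc i)" for i
    unfolding p_def using dec by (subst pmf_embed_pmf) auto
  have lt: "measure (measure_pmf p) {..<i} = 1 - T i" for i
  proof -
    have "measure (measure_pmf p) {..<i} = (\<Sum>k<i. T k - T (Suc k))"
      by (simp add: measure_measure_pmf_finite pmf_p)
    also have "\<dots> = T 0 - T i" by (rule sum_lessThan_telescope')
    finally show ?thesis by (simp add: T_def)
  qed
  have "measure (measure_pmf p) {j. i \<le> j} = T i" for i
  proof -
    have "{j. i \<le> j} = UNIV - {..<i}" by auto
    thus ?thesis using measure_pmf.prob_compl[of "{..<i}" p] by (simp add: lt)
  qed
  thus ?thesis
    unfolding robin_hood_search_cost_def
    by (intro exI[of _ p]) (auto simp: T_def measure_pmf.prob_space_axioms)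
qed

end

theory Submission
  imports Defs "HOL-Real_Asymp.Real_Asymp"
begin

text \<open>
  Write \<open>L = r\<^sub>1 = ln \<beta>\<close>. Since \<open>Pr(X \<ge> i) = (r\<^sub>i - r\<^sub>i\<^sub>+\<^sub>1) / \<alpha>\<close>, telescoping gives \<open>E X = L / \<alpha>\<close>
  and \<open>\<alpha> E X\<^sup>2 = 2 \<Sum> r\<^sub>i - L\<close>. The sum is controlled by the potential \<open>\<Phi>(x) = x\<^sup>2 + x + \<psi>(x)\<close>, where
  \<open>\<psi>(x) = \<integral>\<^sub>0\<^sup>x 2 t / (exp t - 1) dt \<le> \<pi>\<^sup>2 / 3\<close>: as \<open>1 / (exp t - 1)\<close> decreases in \<open>t\<close>, one
  step \<open>x \<mapsto> y = x - 1 + exp (-x)\<close> satisfies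
  \<open>\<psi>(x) - \<psi>(y) \<ge> (x\<^sup>2 - y\<^sup>2) / (exp x - 1) = (x + y) exp (-x)\<close>, which is exactly
  \<open>\<Phi>(x) \<ge> 2 x + \<Phi>(y)\<close>. Hence \<open>2 \<Sum> r\<^sub>i \<le> \<Phi>(L)\<close>, so that
  \<open>Var X \<le> (L\<^sup>2 + \<pi>\<^sup>2 / 3) / \<alpha> - L\<^sup>2 / \<alpha>\<^sup>2 \<le> \<pi>\<^sup>2 / (3 \<alpha>)\<close>. Expanding \<open>1 / (exp t - 1)\<close>
  as a geometric series and integrating termwise turns \<open>\<psi>\<close> into a series, and all
  estimates are made term by term.
\<close>

section \<open>The integral psi as a series\<close>

text \<open>Closed form of the integral of t exp (-t) over [0, u], the Gamma(2,1) distribution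
  function.\<close>

definition gamma_cdf :: "real \<Rightarrow> real" where
  "gamma_cdf u = 1 - (1 + u) * exp (- u)"

lemma gamma_cdf_0: "gamma_cdf 0 = 0"
  by (simp add: gamma_cdf_def)

lemma gamma_cdf_le_1: "0 \<le> u \<Longrightarrow> gamma_cdf u \<le> 1"
  by (simp add: gamma_cdf_def)

text \<open>The difference is the integral of t exp (-t) over [v, u], where exp (-t) is at least exp
  (-u). Integration is avoided: multiplied by exp u, the claim follows from the quadratic Taylor
  bound on exp (u - v).\<close>

lemma gamma_cdf_diff_ge:
  assumes "0 \<le> v" "v \<le> u"
  shows "exp (- u) * (u\<^sup>2 - v\<^sup>2) / 2 \<le> gamma_cdf u - gamma_cdf v"
proof -
  define d where "d = u - v"
  have u: "u = v + d" and d: "0 \<le> d" using assms by (auto simp: d_def)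
  have "(u\<^sup>2 - v\<^sup>2) / 2 + 1 + u \<le> (1 + v) * (1 + d + d\<^sup>2 / 2)"
    using assms(1) d by (simp add: u power2_eq_square algebra_simps)
  also have "\<dots> \<le> (1 + v) * exp d"
    using assms(1) exp_lower_Taylor_quadratic[OF d] by (intro mult_left_mono) auto
  finally have "exp (- u) * ((u\<^sup>2 - v\<^sup>2) / 2 + 1 + u) \<le> exp (- u) * ((1 + v) * exp d)"
    by (intro mult_left_mono) auto
  also have "\<dots> = (1 + v) * exp (- v)"
    by (simp add: u mult.left_commute mult_exp_exp)
  finally show ?thesis by (simp add: gamma_cdf_def algebra_simps)
qed

lemma gamma_cdf_nonneg:
  assumes "0 \<le> u"
  shows "0 \<le> gamma_cdf u"
proof -
  have "0 \<le> exp (- u) * (u\<^sup>2 - 0\<^sup>2) / 2" by simp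
  also have "\<dots> \<le> gamma_cdf u" using gamma_cdf_diff_ge[of 0 u] assms by (simp add: gamma_cdf_0)
  finally show ?thesis .
qed

text \<open>This is psi: with k = n + 1, the integral of 2 t exp (-k t) over [0, x] equals 2 / k^2
  times \<open>gamma_cdf\<close> at k x.\<close>

definition bose_integral :: "real \<Rightarrow> real" where
  "bose_integral x = (\<Sum>n. 2 / (real (Suc n))\<^sup>2 * gamma_cdf (real (Suc n) * x))"

lemma two_over_squares_sums: "(\<lambda>n. 2 / (real (Suc n))\<^sup>2) sums (pi\<^sup>2 / 3)"
  using sums_mult[OF inverse_squares_sums, of 2] by (simp add: add.commute)

lemma bose_integral_summable:
  assumes "0 \<le> x"
  shows "summable (\<lambda>n. 2 / (real (Suc n))\<^sup>2 * gamma_cdf (real (Suc n) * x))"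
proof (rule summable_comparison_test'[OF sums_summable[OF two_over_squares_sums]])
  fix n :: nat
  show "norm (2 / (real (Suc n))\<^sup>2 * gamma_cdf (real (Suc n) * x)) \<le> 2 / (real (Suc n))\<^sup>2"
    using gamma_cdf_nonneg[of "real (Suc n) * x"] gamma_cdf_le_1[of "real (Suc n) * x"] assms
    by (simp add: divide_right_mono abs_mult del: of_nat_Suc)
qed

lemma bose_integral_nonneg:
  assumes "0 \<le> x"
  shows "0 \<le> bose_integral x"
  unfolding bose_integral_def
  using assms by (intro suminf_nonneg bose_integral_summable mult_nonneg_nonneg gamma_cdf_nonneg) auto

lemma bose_integral_le:
  assumes "0 \<le> x"
  shows "bose_integral x \<le> pi\<^sup>2 / 3"
proof -
  have "bose_integral x \<le> (\<Sum>n. 2 / (real (Suc n))\<^sup>2)"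
    unfolding bose_integral_def
  proof (intro suminf_le bose_integral_summable assms sums_summable[OF two_over_squares_sums])
    fix n :: nat
    show "2 / (real (Suc n))\<^sup>2 * gamma_cdf (real (Suc n) * x) \<le> 2 / (real (Suc n))\<^sup>2"
      using gamma_cdf_le_1[of "real (Suc n) * x"] assms
      by (intro mult_left_le) auto
  qed
  thus ?thesis using sums_unique[OF two_over_squares_sums] by simp
qed

text \<open>Apply \<open>gamma_cdf_diff_ge\<close> at k x and k y: the factor k^2 cancels, and the
  remaining exp (-k x) sum to 1 / (exp x - 1).\<close>

lemma bose_integral_diff_ge:
  assumes "0 \<le> y" "y \<le> x" "0 < x"
  shows "(x\<^sup>2 - y\<^sup>2) / (exp x - 1) \<le> bose_integral x - bose_integral y"
proof -
  have "(\<lambda>n. exp (- x) ^ n) sums (1 / (1 - exp (- x)))"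
    using assms by (intro geometric_sums) auto
  \<comment> \<open>The extra factor exp (-x) makes the geometric series start at exponent
    1.\<close>
  from sums_mult[OF this, of "(x\<^sup>2 - y\<^sup>2) * exp (- x)"]
  have "(\<lambda>n. (x\<^sup>2 - y\<^sup>2) * exp (- x) * exp (- x) ^ n)
      sums ((x\<^sup>2 - y\<^sup>2) * exp (- x) / (1 - exp (- x)))"
    by simp
  moreover have "exp (- (real (Suc n) * x)) = exp (- x) * exp (- x) ^ n" for n
    using exp_of_nat_mult[of "Suc n" "- x"] by simp
  ultimately
  have "(\<lambda>n. (x\<^sup>2 - y\<^sup>2) * exp (- (real (Suc n) * x)))
      sums ((x\<^sup>2 - y\<^sup>2) * exp (- x) / (1 - exp (- x)))"
    by (simp only: mult.assoc)
  also have "(x\<^sup>2 - y\<^sup>2) * exp (- x) / (1 - exp (- x)) = (x\<^sup>2 - y\<^sup>2) / (exp x - 1)"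
    using assms by (simp add: exp_minus field_simps)
  finally have lhs: "(\<lambda>n. (x\<^sup>2 - y\<^sup>2) * exp (- (real (Suc n) * x)))
      sums ((x\<^sup>2 - y\<^sup>2) / (exp x - 1))" .
  have rhs: "(\<lambda>n. 2 / (real (Suc n))\<^sup>2 * gamma_cdf (real (Suc n) * x)
        - 2 / (real (Suc n))\<^sup>2 * gamma_cdf (real (Suc n) * y))
      sums (bose_integral x - bose_integral y)"
    unfolding bose_integral_def
    using assms by (intro sums_diff summable_sums bose_integral_summable) auto
  show ?thesis
  proof (rule sums_le[OF _ lhs rhs])
    fix n :: nat
    let ?k = "real (Suc n)"
    have k: "?k > 0" by simp
    have "(x\<^sup>2 - y\<^sup>2) * exp (- (?k * x))
        = 2 / ?k\<^sup>2 * (exp (- (?k * x)) * ((?k * x)\<^sup>2 - (?k * y)\<^sup>2) / 2)"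
      using k by (simp add: power_mult_distrib field_simps del: of_nat_Suc)
    also have "\<dots> \<le> 2 / ?k\<^sup>2 * (gamma_cdf (?k * x) - gamma_cdf (?k * y))"
      using k assms by (intro mult_left_mono gamma_cdf_diff_ge) auto
    finally show "(x\<^sup>2 - y\<^sup>2) * exp (- (?k * x))
        \<le> 2 / ?k\<^sup>2 * gamma_cdf (?k * x) - 2 / ?k\<^sup>2 * gamma_cdf (?k * y)"
      by (simp add: right_diff_distrib)
  qed
qed

section \<open>The potential and its drop in one step\<close>

definition rh_potential :: "real \<Rightarrow> real" where
  "rh_potential x = x\<^sup>2 + x + bose_integral x"

text \<open>With y the next value, x^2 + x drops by exactly 2 x - (x + y) exp (-x); the drop of
  \<open>bose_integral\<close> makes up the deficit.\<close>

lemma rh_potential_step: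
  assumes "0 < x"
  shows "2 * x + rh_potential (x - 1 + exp (- x)) \<le> rh_potential x"
proof -
  define y where "y = x - 1 + exp (- x)"
  have y: "0 \<le> y" "y \<le> x"
    using exp_ge_add_one_self[of "- x"] assms by (auto simp: y_def)
  have h: "x - y = 1 - exp (- x)" by (simp add: y_def)
  have "(x\<^sup>2 - y\<^sup>2) / (exp x - 1) = (x + y) * ((x - y) / (exp x - 1))"
    by (simp add: power2_eq_square algebra_simps)
  also have "(x - y) / (exp x - 1) = exp (- x)"
    using assms by (simp add: h exp_minus field_simps)
  finally have "(x + y) * exp (- x) \<le> bose_integral x - bose_integral y"
    using bose_integral_diff_ge[OF y assms] by simp
  moreover have "2 * x + y\<^sup>2 + y = x\<^sup>2 + x + (x + y) * exp (- x)"
  proof -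
    have e: "exp (- x) = 1 - x + y" by (simp add: y_def)
    show ?thesis unfolding e by (simp add: power2_eq_square algebra_simps)
  qed
  ultimately show ?thesis by (simp add: rh_potential_def flip: y_def)
qed

section \<open>Sums along the recurrence\<close>

context
  fixes \<alpha> :: real
  assumes \<alpha>: "0 < \<alpha>" "\<alpha> < 1"
begin

text \<open>The potential of the next iterate is kept on the left to absorb a boundary term in
  \<open>weighted_sum_rh_r_le\<close>.\<close>

lemma sum_rh_r_le:
  "2 * (\<Sum>k<n. rh_r \<alpha> (Suc k)) + rh_potential (rh_r \<alpha> (Suc n)) \<le> rh_potential (ln (beta \<alpha>))"
proof (induction n)
  case 0
  show ?case using rh_r_1 by simp
next
  case (Suc n)
  show ?case
    using Suc rh_potential_step[OF rh_r_pos[OF \<alpha>, of "Suc n"]] rh_r_Suc[of "Suc n" \<alpha>] by simp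
qed

text \<open>Summation by parts. The left side is a partial sum of \<alpha> E X^2, as 2 k + 1 = (k +
  1)^2 - k^2.\<close>

lemma weighted_sum_rh_r:
  "(\<Sum>k<n. (2 * real k + 1) * (rh_r \<alpha> (Suc k) - rh_r \<alpha> (Suc (Suc k))))
    = 2 * (\<Sum>k<n. rh_r \<alpha> (Suc k)) - ln (beta \<alpha>) - (2 * real n - 1) * rh_r \<alpha> (Suc n)"
proof (induction n)
  case 0
  show ?case using rh_r_1 by simp
next
  case (Suc n)
  thus ?case by (simp add: algebra_simps)
qed

text \<open>The boundary term is r - 2 n r: its first part is at most the retained potential of r,
  its second is nonpositive. The bound is thus uniform in n, without a decay rate for r.\<close>

lemma weighted_sum_rh_r_le:
  "(\<Sum>k<n. (2 * real k + 1) * (rh_r \<alpha> (Suc k) - rh_r \<alpha> (Suc (Suc k))))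
    \<le> (ln (beta \<alpha>))\<^sup>2 + pi\<^sup>2 / 3"
proof -
  let ?r = "rh_r \<alpha> (Suc n)"
  have r: "0 < ?r" using rh_r_pos[OF \<alpha>] by simp
  have L: "0 < ln (beta \<alpha>)" using rh_r_pos[OF \<alpha>, of 1] rh_r_1 by simp
  have "?r \<le> rh_potential ?r"
    using r bose_integral_nonneg[of ?r] by (simp add: rh_potential_def)
  moreover have "0 \<le> real n * ?r" using r by simp
  ultimately show ?thesis
    using sum_rh_r_le[of n] bose_integral_le[of "ln (beta \<alpha>)"] L
    unfolding weighted_sum_rh_r by (simp add: rh_potential_def algebra_simps)
qed

section \<open>Moments of the search cost\<close>

context
  fixes M :: "'a measure" and X :: "'a \<Rightarrow> nat"
  assumes rh: "robin_hood_search_cost \<alpha> M X"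
begin

interpretation prob_space M
  using rh by (simp add: robin_hood_search_cost_def)

lemma X_measurable [measurable]: "X \<in> M \<rightarrow>\<^sub>M count_space UNIV"
  using rh by (simp add: robin_hood_search_cost_def)

lemma prob_search_cost_gt:
  "prob {\<omega> \<in> space M. k < X \<omega>} = (rh_r \<alpha> (Suc k) - rh_r \<alpha> (Suc (Suc k))) / \<alpha>"
proof -
  have "prob {\<omega> \<in> space M. Suc k \<le> X \<omega>} = (1 - exp (- rh_r \<alpha> (Suc k))) / \<alpha>"
    using rh by (simp add: robin_hood_search_cost_def)
  thus ?thesis using rh_r_Suc[of "Suc k" \<alpha>] by (simp add: Suc_le_eq)
qed

text \<open>E X is the sum of Pr(X > k) over k \<ge> 0, which telescopes because the iterates tend
  to 0.\<close>

lemma nn_integral_search_cost: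
  "(\<integral>\<^sup>+ \<omega>. ennreal (real (X \<omega>)) \<partial>M) = ennreal (ln (beta \<alpha>) / \<alpha>)"
proof -
  have "(\<lambda>k. rh_r \<alpha> (0 + Suc k) - rh_r \<alpha> (0 + Suc (Suc k))) sums (rh_r \<alpha> (0 + Suc 0) - 0)"
    by (rule telescope_sums'[OF rh_r_tendsto_0[OF \<alpha>]])
  from sums_divide[OF this, of \<alpha>]
  have sums: "(\<lambda>k. prob {\<omega> \<in> space M. k < X \<omega>}) sums (ln (beta \<alpha>) / \<alpha>)"
    using rh_r_1 by (simp add: prob_search_cost_gt)
  have "(\<integral>\<^sup>+ \<omega>. ennreal (real (X \<omega>)) \<partial>M) = (\<Sum>k. emeasure M {\<omega> \<in> space M. k < X \<omega>})"
    using nn_integral_nat_function[OF X_measurable] by (simp add: ennreal_of_nat_eq_real_of_nat)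
  also have "\<dots> = (\<Sum>k. ennreal (prob {\<omega> \<in> space M. k < X \<omega>}))"
    by (simp add: emeasure_eq_measure)
  also have "\<dots> = ennreal (ln (beta \<alpha>) / \<alpha>)"
    using sums by (subst suminf_ennreal2) (auto simp: sums_iff)
  finally show ?thesis .
qed

text \<open>Write X^2 as the sum of the odd numbers 2 k + 1 over k < X, exchange sum and integral,
  and bound every partial sum.\<close>

lemma nn_integral_search_cost_squared_le:
  "(\<integral>\<^sup>+ \<omega>. ennreal ((real (X \<omega>))\<^sup>2) \<partial>M) \<le> ennreal (((ln (beta \<alpha>))\<^sup>2 + pi\<^sup>2 / 3) / \<alpha>)"
proof -
  let ?A = "\<lambda>k. {\<omega> \<in> space M. k < X \<omega>}"
  have square: "ennreal ((real (X \<omega>))\<^sup>2) = (\<Sum>k. ennreal (2 * real k + 1) * indicator (?A k) \<omega>)"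
    if "\<omega> \<in> space M" for \<omega>
  proof -
    have odds: "(\<Sum>k<n. 2 * real k + 1) = (real n)\<^sup>2" for n
      by (induction n) (simp_all add: power2_eq_square algebra_simps)
    have "(\<Sum>k. ennreal (2 * real k + 1) * indicator (?A k) \<omega>)
        = (\<Sum>k<X \<omega>. ennreal (2 * real k + 1) * indicator (?A k) \<omega>)"
      using that by (intro suminf_finite) (auto simp: indicator_def)
    also have "\<dots> = (\<Sum>k<X \<omega>. ennreal (2 * real k + 1))"
      using that by (intro sum.cong) (auto simp: indicator_def)
    also have "\<dots> = ennreal ((real (X \<omega>))\<^sup>2)"
      by (subst sum_ennreal) (auto simp: odds)
    finally show ?thesis by simp
  qed
  have "(\<integral>\<^sup>+ \<omega>. ennreal ((real (X \<omega>))\<^sup>2) \<partial>M)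
      = (\<integral>\<^sup>+ \<omega>. (\<Sum>k. ennreal (2 * real k + 1) * indicator (?A k) \<omega>) \<partial>M)"
    using square by (rule nn_integral_cong)
  also have "\<dots> = (\<Sum>k. \<integral>\<^sup>+ \<omega>. ennreal (2 * real k + 1) * indicator (?A k) \<omega> \<partial>M)"
    by (rule nn_integral_suminf) measurable
  also have "\<dots> = (\<Sum>k. ennreal ((2 * real k + 1) * prob (?A k)))"
    by (simp add: nn_integral_cmult_indicator emeasure_eq_measure ennreal_mult)
  also have "\<dots> \<le> ennreal (((ln (beta \<alpha>))\<^sup>2 + pi\<^sup>2 / 3) / \<alpha>)"
  proof (rule suminf_le_const[OF summableI])
    fix n
    have "(\<Sum>k<n. ennreal ((2 * real k + 1) * prob (?A k)))
        = ennreal (\<Sum>k<n. (2 * real k + 1) * prob (?A k))"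
      by (rule sum_ennreal) auto
    also have "(\<Sum>k<n. (2 * real k + 1) * prob (?A k))
        = (\<Sum>k<n. (2 * real k + 1) * (rh_r \<alpha> (Suc k) - rh_r \<alpha> (Suc (Suc k)))) / \<alpha>"
      by (simp add: prob_search_cost_gt sum_divide_distrib)
    also have "ennreal \<dots> \<le> ennreal (((ln (beta \<alpha>))\<^sup>2 + pi\<^sup>2 / 3) / \<alpha>)"
      using \<alpha> by (intro ennreal_leI divide_right_mono weighted_sum_rh_r_le) auto
    finally show "(\<Sum>k<n. ennreal ((2 * real k + 1) * prob (?A k)))
        \<le> ennreal (((ln (beta \<alpha>))\<^sup>2 + pi\<^sup>2 / 3) / \<alpha>)" .
  qed
  finally show ?thesis .
qed

lemma integrable_search_cost_squared: "integrable M (\<lambda>\<omega>. (real (X \<omega>))\<^sup>2)"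
proof (rule integrableI_bounded)
  have "(\<integral>\<^sup>+ \<omega>. ennreal (norm ((real (X \<omega>))\<^sup>2)) \<partial>M) \<le> ennreal (((ln (beta \<alpha>))\<^sup>2 + pi\<^sup>2 / 3) / \<alpha>)"
    using nn_integral_search_cost_squared_le by simp
  thus "(\<integral>\<^sup>+ \<omega>. ennreal (norm ((real (X \<omega>))\<^sup>2)) \<partial>M) < \<infinity>"
    using ennreal_less_top le_less_trans by (auto simp: top_ennreal_def)
qed measurable

lemma variance_search_cost_le: "variance (\<lambda>\<omega>. real (X \<omega>)) \<le> pi\<^sup>2 / (3 * \<alpha>)"
proof -
  let ?L = "ln (beta \<alpha>)"
  have L: "0 < ?L" using rh_r_pos[OF \<alpha>, of 1] rh_r_1 by simp
  have EX: "has_bochner_integral M (\<lambda>\<omega>. real (X \<omega>)) (?L / \<alpha>)"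
    using L \<alpha> nn_integral_search_cost by (intro has_bochner_integral_nn_integral) auto
  have "ennreal (expectation (\<lambda>\<omega>. (real (X \<omega>))\<^sup>2)) \<le> ennreal ((?L\<^sup>2 + pi\<^sup>2 / 3) / \<alpha>)"
    using nn_integral_search_cost_squared_le
    by (subst nn_integral_eq_integral[OF integrable_search_cost_squared, symmetric]) auto
  hence EX2: "expectation (\<lambda>\<omega>. (real (X \<omega>))\<^sup>2) \<le> (?L\<^sup>2 + pi\<^sup>2 / 3) / \<alpha>"
    using \<alpha> by (subst (asm) ennreal_le_iff) auto
  have "variance (\<lambda>\<omega>. real (X \<omega>)) = expectation (\<lambda>\<omega>. (real (X \<omega>))\<^sup>2) - (?L / \<alpha>)\<^sup>2"
    using variance_eq[OF integrable.intros[OF EX] integrable_search_cost_squared]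
    by (simp add: has_bochner_integral_integral_eq[OF EX])
  also have "\<dots> \<le> (?L\<^sup>2 + pi\<^sup>2 / 3) / \<alpha> - (?L / \<alpha>)\<^sup>2" using EX2 by simp
  \<comment> \<open>The two L^2 terms combine into a single term, nonpositive since \<alpha> <
    1.\<close>
  also have "\<dots> = pi\<^sup>2 / (3 * \<alpha>) - ?L\<^sup>2 * (1 - \<alpha>) / \<alpha>\<^sup>2"
    using \<alpha> by (simp add: field_simps power2_eq_square)
  also have "\<dots> \<le> pi\<^sup>2 / (3 * \<alpha>)" using \<alpha> by simp
  finally show ?thesis .
qed

end

end

section \<open>The error term\<close>

text \<open>The witness g is the excess of pi^2 / (3 \<alpha>) over pi^2 / 3. It is of order 1 /
  \<beta>, hence O(ln \<beta> / \<beta>) as ln \<beta> tends to infinity.\<close>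

lemma inverse_beta_bigo:
  "(\<lambda>\<alpha>. pi\<^sup>2 / 3 * ((1 - \<alpha>) / \<alpha>)) \<in> O[at_left 1](\<lambda>\<alpha>. ln (beta \<alpha>) / beta \<alpha>)"
  unfolding beta_def by real_asymp

theorem theorem2:
  fixes M :: "real \<Rightarrow> 'a measure" and X :: "real \<Rightarrow> 'a \<Rightarrow> nat"
  assumes "\<And>\<alpha>. 0 < \<alpha> \<Longrightarrow> \<alpha> < 1 \<Longrightarrow> robin_hood_search_cost \<alpha> (M \<alpha>) (X \<alpha>)"
  shows "(\<forall>\<alpha>. 0 < \<alpha> \<and> \<alpha> < 1 \<longrightarrow> integrable (M \<alpha>) (\<lambda>\<omega>. (real (X \<alpha> \<omega>))\<^sup>2)) \<and>
    (\<exists>g :: real \<Rightarrow> real.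
       g \<in> O[at_left 1](\<lambda>\<alpha>. ln (beta \<alpha>) / beta \<alpha>) \<and>
       (\<forall>\<alpha>. 0 < \<alpha> \<and> \<alpha> < 1 \<longrightarrow>
          prob_space.variance (M \<alpha>) (\<lambda>\<omega>. real (X \<alpha> \<omega>)) \<le> pi\<^sup>2 / 3 + 1 / 3 + g \<alpha>))"
proof (intro conjI allI impI exI[of _ "\<lambda>\<alpha>. pi\<^sup>2 / 3 * ((1 - \<alpha>) / \<alpha>)"] inverse_beta_bigo)
  fix \<alpha> :: real
  assume \<alpha>: "0 < \<alpha> \<and> \<alpha> < 1"
  show "integrable (M \<alpha>) (\<lambda>\<omega>. (real (X \<alpha> \<omega>))\<^sup>2)"
    using \<alpha> assms by (intro integrable_search_cost_squared) auto
  have "prob_space.variance (M \<alpha>) (\<lambda>\<omega>. real (X \<alpha> \<omega>)) \<le> pi\<^sup>2 / (3 * \<alpha>)"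
    using \<alpha> assms by (intro variance_search_cost_le) auto
  also have "\<dots> = pi\<^sup>2 / 3 + pi\<^sup>2 / 3 * ((1 - \<alpha>) / \<alpha>)"
    using \<alpha> by (simp add: field_simps)
  \<comment> \<open>The bound just derived is sharper than the claim by 1/3.\<close>
  finally show "prob_space.variance (M \<alpha>) (\<lambda>\<omega>. real (X \<alpha> \<omega>))
      \<le> pi\<^sup>2 / 3 + 1 / 3 + pi\<^sup>2 / 3 * ((1 - \<alpha>) / \<alpha>)" by simp
qed

end
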